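(* Let $(T_n,\rho_n)$ satisfy $T_n\to\infty$, $\rho_n\to0$ and $\rho_n^{-1}=o(n^2)$ as $n\to\infty$, and let $P_{1,n}=P_1(n,T_n,\rho_n)$, $P_{0,n}=P_0(n,T_n,\rho_n)$. For $\boldsymbol\tau\in\mathcal S_{T_n}$ let $P_{1,\boldsymbol\tau,n}$ denote the conditional distribution under $P_{1,n}$ given $\boldsymbol\tau$. If $nT_n\rho_n\to0$, then $$d_{\chi^2}(P_{1,\boldsymbol\tau,n},P_{0,n})=\sum_{\mathbf A}\frac{P_{1,\boldsymbol\tau,n}^2(\mathbf A)}{P_{0,n}(\mathbf A)}-1=o(1)\qquad\text{for all }\boldsymbol\tau\in\mathcal S_{T_n}.$$ As a result, $d_{\chi^2}(P_{1,n},P_{0,n})=o(1)$, and $P_{1,n}$ and $P_{0,n}$ are not distinguishable.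
   Context: Throughout, $n$ and $T$ are even positive integers, $[m]=\{1,\dots,m\}$, and for even $m$, $\mathcal S_m=\{\boldsymbol\sigma\in\{0,1\}^m:\sum_{i\in[m]}\sigma(i)=m/2\}$. For $\rho\in(0,2/3)$ let $B^{(0)}$ and $B^{(1)}$ be the symmetric $2\times 2$ matrices with rows and columns indexed by $\{0,1\}$: $B^{(0)}$ has diagonal entries $\frac32\rho$ and off-diagonal entries $\frac12\rho$; $B^{(1)}$ has diagonal entries $\frac12\rho$ and off-diagonal entries $\frac32\rho$. Model $P_1(n,T,\rho)$: the joint law of $(\mathbf A,\boldsymbol\sigma,\boldsymbol\tau)$ where $\boldsymbol\sigma\sim\mathrm{Uniform}(\mathcal S_n)$ and $\boldsymbol\tau\sim\mathrm{Uniform}(\mathcal S_T)$ are independent and, given $(\boldsymbol\sigma,\boldsymbol\tau)$, the entries $A_t(i,j)$, $1\le i<j\le n$, $t\in[T]$, of $\mathbf A$ are independent with $A_t(i,j)\sim\mathrm{Bernoulli}(B^{(\tau(t))}(\sigma(i),\sigma(j)))$. Model $P_0(n,T,\rho)$: the $A_t(i,j)$ are i.i.d. $\mathrm{Bernoulli}(\rho)$. Only $\mathbf A$ is observed. $P_{1,\boldsymbol\tau,n}(\mathbf A)$ and $P_{1,n}(\mathbf A)$ denote the probabilities of $\mathbf A\in\{0,1\}^{\binom n2\times T_n}$ under the corresponding marginal law of $\mathbf A$ (i.e. with $\boldsymbol\sigma$, respectively $\boldsymbol\sigma$ and $\boldsymbol\tau$, averaged out), and $\chi^2$-divergences are between these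 laws of $\mathbf A$. For distributions $Q,P$ with probability mass functions $q,p$ on a common space $\mathcal X$, $d_{\chi^2}(Q,P)=\sum_{x\in\mathcal X}q^2(x)/p(x)-1$. Distinguishable: there is a sequence of tests $\hat\psi(\mathbf A)\in\{0,1\}$ (no computational restriction) with $P_{1,n}(\hat\psi(\mathbf A)=0)+P_{0,n}(\hat\psi(\mathbf A)=1)\to0$. *)

theory Defs
  imports "HOL-Probability.Probability" "HOL-Library.Landau_Symbols"
begin

definition balanced :: "nat \<Rightarrow> (nat \<Rightarrow> nat) set" where
  "balanced m = {\<sigma> \<in> {1..m} \<rightarrow>\<^sub>E {0, 1}. real (\<Sum>i\<in>{1..m}. \<sigma> i) = real m / 2}"

definition Bmat :: "real \<Rightarrow> nat \<Rightarrow> nat \<Rightarrow> nat \<Rightarrow> real" where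
  "Bmat \<rho> k a b =
     (if k = 0 then (if a = b then 3 / 2 * \<rho> else 1 / 2 * \<rho>)
      else (if a = b then 1 / 2 * \<rho> else 3 / 2 * \<rho>))"

text \<open>An observation \<open>A\<close> maps \<open>(t, i, j)\<close> to the entry \<open>A\<^sub>t(i, j)\<close>.
  Only the triples in \<open>entries n T\<close> carry data; elsewhere \<open>A\<close> is \<open>False\<close>, so that
  \<open>arrays n T\<close> is a copy of the finite set of 0/1-arrays indexed by \<open>entries n T\<close>.\<close>

type_synonym array = "nat \<times> nat \<times> nat \<Rightarrow> bool"

definition entries :: "nat \<Rightarrow> nat \<Rightarrow> (nat \<times> nat \<times> nat) set" where
  "entries n T = {(t, i, j). t \<in> {1..T} \<and> 1 \<le> i \<and> i < j \<and> j \<le> n}"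

definition arrays :: "nat \<Rightarrow> nat \<Rightarrow> array set" where
  "arrays n T = PiE_dflt (entries n T) False (\<lambda>_. UNIV)"

definition joint_law ::
  "nat \<Rightarrow> nat \<Rightarrow> real \<Rightarrow> (array \<times> (nat \<Rightarrow> nat) \<times> (nat \<Rightarrow> nat)) pmf" where
  "joint_law n T \<rho> =
     do {
       \<sigma> \<leftarrow> pmf_of_set (balanced n);
       \<tau> \<leftarrow> pmf_of_set (balanced T);
       A \<leftarrow> Pi_pmf (entries n T) False
              (\<lambda>(t, i, j). bernoulli_pmf (Bmat \<rho> (\<tau> t) (\<sigma> i) (\<sigma> j)));
       return_pmf (A, \<sigma>, \<tau>)
     }"

definition alt_law :: "nat \<Rightarrow> nat \<Rightarrow> real \<Rightarrow> array pmf" where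
  "alt_law n T \<rho> = map_pmf fst (joint_law n T \<rho>)"

definition alt_law_given :: "(nat \<Rightarrow> nat) \<Rightarrow> nat \<Rightarrow> nat \<Rightarrow> real \<Rightarrow> array pmf" where
  "alt_law_given \<tau> n T \<rho> =
     map_pmf fst (cond_pmf (joint_law n T \<rho>) {(A, \<sigma>, \<tau>'). \<tau>' = \<tau>})"

definition null_law :: "nat \<Rightarrow> nat \<Rightarrow> real \<Rightarrow> array pmf" where
  "null_law n T \<rho> = Pi_pmf (entries n T) False (\<lambda>_. bernoulli_pmf \<rho>)"

text \<open>Intended for a finite space \<open>X\<close> on which \<open>P\<close> has full support
  (true of \<open>null_law n T \<rho>\<close> on \<open>arrays n T\<close> for \<open>0 < \<rho> < 1\<close>), so that no term
  divides by zero.\<close>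

definition chi2_div :: "'a set \<Rightarrow> 'a pmf \<Rightarrow> 'a pmf \<Rightarrow> real" where
  "chi2_div X Q P = (\<Sum>x\<in>X. (pmf Q x)\<^sup>2 / pmf P x) - 1"

text \<open>The limit \<open>n \<rightarrow> \<infinity>\<close> along even \<open>n\<close>; values at odd \<open>n\<close> are ignored.\<close>

definition even_at_top :: "nat filter" where
  "even_at_top = inf at_top (principal {n. even n})"

definition distinguishable :: "(nat \<Rightarrow> 'a pmf) \<Rightarrow> (nat \<Rightarrow> 'a pmf) \<Rightarrow> bool" where
  "distinguishable P1 P0 \<longleftrightarrow>
     (\<exists>\<psi> :: nat \<Rightarrow> 'a \<Rightarrow> bool.
        ((\<lambda>n. measure_pmf.prob (P1 n) {A. \<not> \<psi> n A} + measure_pmf.prob (P0 n) {A. \<psi> n A})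
           \<longlongrightarrow> 0) even_at_top)"

end

theory Submission
  imports Defs
begin

text \<open>Expanding the second moment over two independent labellings \<open>\<sigma>, \<sigma>'\<close>, with \<open>x\<^sub>i = \<plusminus>1\<close>
  according to whether \<open>\<sigma>\<close> and \<open>\<sigma>'\<close> agree at \<open>i\<close>, gives \<open>\<chi>\<^sup>2 + 1\<close> as the mean of the product of
  \<open>1 + c x\<^sub>i x\<^sub>j\<close> over all entries, where \<open>c = \<rho> / (4 (1 - \<rho>))\<close>: the signs of \<open>\<tau>\<close> square away. This is
  at most the mean of \<open>exp (T c X\<^sup>2 / 2)\<close> with \<open>X\<close> the sum of the \<open>x\<^sub>i\<close>. Writing \<open>n = 2 m\<close> and
  \<open>Y\<close> for the common ones of \<open>\<sigma>\<close> and \<open>\<sigma>'\<close>, \<open>X = 2 (2 |Y| - m)\<close> and \<open>|Y|\<close> is hypergeometric. Its law is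
  at most twice the binomial law with parameters \<open>m\<close> and \<open>1/2\<close>, because
  \<open>C(m, m div 2) 2\<^sup>m \<le> 2 C(2m, m)\<close>, so \<open>exp ((2 |Y| - m)\<^sup>2 / (4 m))\<close> has mean at most 4.
  Since the actual exponent is smaller by a factor \<open>\<epsilon> \<le> 3 n T \<rho>\<close>, convexity of \<open>exp\<close> yields
  \<open>\<chi>\<^sup>2 \<le> 3 \<epsilon>\<close>. Averaging over \<open>\<tau>\<close> preserves the bound by convexity of the square, and
  Cauchy--Schwarz bounds the advantage of every test by the square root of \<open>\<chi>\<^sup>2\<close>.\<close>

section \<open>Exponential moments of the square of a Rademacher sum\<close>

text \<open>Hoeffding's lemma for a fair sign: with step \<open>2 * x\<close> and probability 1/2
  its left side is the logarithm of cosh, which covers \<open>x \<ge> 0\<close>, and cosh is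
  even.\<close>

lemma cosh_le_exp_half_square: "cosh x \<le> exp (x\<^sup>2 / 2)" for x :: real
proof -
  have *: "cosh x \<le> exp (x\<^sup>2 / 2)" if "x \<ge> 0" for x :: real
  proof -
    have pos: "1 + 1 / 2 * (exp (2 * x) - 1) > (0::real)"
      using exp_gt_zero[of "2 * x"] by (simp add: field_simps add_pos_pos)
    have "cosh x = exp (- (2 * x) * (1 / 2) + ln (1 + 1 / 2 * (exp (2 * x) - 1)))"
      using pos by (simp only: exp_add exp_ln)
        (simp add: cosh_def field_simps flip: exp_add)
    also have "\<dots> \<le> exp ((2 * x)\<^sup>2 / 8)"
      using Hoeffdings_lemma_aux[of "2 * x" "1 / 2"] that by simp
    finally show ?thesis by (simp add: power2_eq_square)
  qed
  show ?thesis
    using *[of x] *[of "- x"] by (cases "x \<ge> 0") auto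
qed

text \<open>Adding one Rademacher step to the sum \<open>z\<close> turns the parameter \<open>\<lambda>\<close> into
  \<open>\<lambda> + 2 * \<lambda>\<^sup>2\<close>, which drives the induction.\<close>

lemma sum_exp_square_subsets_le:
  fixes l :: real
  assumes "finite S" "0 \<le> l" "2 * l * card S < 1"
  shows "(\<Sum>Y\<in>Pow S. exp (l * (2 * real (card Y) - real (card S))\<^sup>2))
           \<le> 2 ^ card S / (1 - 2 * l * card S)"
  using assms
proof (induction S arbitrary: l rule: finite_induct)
  case empty
  then show ?case by simp
next
  case (insert x S)
  define k where "k = real (card S)"
  define m where "m = l + 2 * l\<^sup>2"
  have cardI: "card (insert x S) = Suc (card S)" using insert by simp
  have k0: "k \<ge> 0" by (simp add: k_def)
  have l1: "2 * l * (k + 1) < 1" using insert.prems cardI by (simp add: k_def algebra_simps)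
  have m0: "m \<ge> 0" using insert.prems by (simp add: m_def)
  have "2 * l * k \<le> 2 * l * (k + 1)" using insert.prems by (simp add: mult_left_mono)
  hence lk: "2 * l * k < 1" using l1 by simp
  have ll: "l * (2 * l * k) \<le> l * 1" using lk insert.prems by (intro mult_left_mono) auto
  have "0 \<le> l * k" using insert.prems k0 by simp
  hence le1: "l \<le> 1" using l1 insert.prems by (simp add: algebra_simps)
  have mk: "1 - 2 * m * k \<ge> 1 - 2 * l * (k + 1)"
    using ll by (simp add: m_def algebra_simps power2_eq_square)
  \<comment> \<open>The gain from raising the cardinality to \<open>k + 1\<close> in the denominator
    pays for the factor \<open>exp l\<close>. The only positive error term,
    \<open>2 * l * (l * k)\<close>, is absorbed by \<open>- l\<close> because
    \<open>2 * l * k < 1\<close>.\<close>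
  have step: "exp l * (1 - 2 * l * (k + 1)) \<le> 1 - 2 * m * k"
  proof -
    have "exp l * (1 - 2 * l * (k + 1)) \<le> (1 + l + l\<^sup>2) * (1 - 2 * l * (k + 1))"
      using exp_bound[of l] le1 insert.prems l1 by (intro mult_right_mono) auto
    also have "\<dots> = 1 - 2 * m * k - l - l\<^sup>2 + 2 * l * (l * k) - 2 * l * l\<^sup>2 * (k + 1)"
      by (simp add: m_def algebra_simps power2_eq_square)
    also have "\<dots> \<le> 1 - 2 * m * k"
    proof -
      have "2 * l * l\<^sup>2 * (k + 1) \<ge> 0" "l\<^sup>2 \<ge> 0" using insert.prems k0 by auto
      moreover have "2 * l * (l * k) \<le> l" using ll by (simp add: mult_ac)
      ultimately show ?thesis by linarith
    qed
    finally show ?thesis .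
  qed
  \<comment> \<open>Leaving \<open>x\<close> out or putting it in shifts \<open>z\<close> by -1 or
    +1. The cross terms combine to a cosh, and the bound on it adds
    \<open>2 * l\<^sup>2 * z\<^sup>2\<close> to the exponent.\<close>
  have pair: "exp (l * (z - 1)\<^sup>2) + exp (l * (z + 1)\<^sup>2) \<le> 2 * exp l * exp (m * z\<^sup>2)" for z
  proof -
    have "exp (l * (z - 1)\<^sup>2) + exp (l * (z + 1)\<^sup>2)
        = exp (l + l * z\<^sup>2) * (exp (- (2 * l * z)) + exp (2 * l * z))"
      by (simp add: distrib_left power2_eq_square algebra_simps flip: exp_add)
    also have "\<dots> = exp (l + l * z\<^sup>2) * (2 * cosh (2 * l * z))"
      by (simp add: cosh_def)
    also have "\<dots> \<le> exp (l + l * z\<^sup>2) * (2 * exp ((2 * l * z)\<^sup>2 / 2))"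
      by (intro mult_left_mono cosh_le_exp_half_square) auto
    also have "\<dots> = 2 * exp l * exp (m * z\<^sup>2)"
      by (simp add: m_def power2_eq_square algebra_simps flip: exp_add)
    finally show ?thesis .
  qed
  have inj: "inj_on (insert x) (Pow S)" using insert.hyps by (auto simp: inj_on_def)
  have "(\<Sum>Y\<in>Pow (insert x S). exp (l * (2 * real (card Y) - real (card (insert x S)))\<^sup>2))
      = (\<Sum>Y\<in>Pow S. exp (l * (2 * real (card Y) - (k + 1))\<^sup>2))
        + (\<Sum>Y\<in>insert x ` Pow S. exp (l * (2 * real (card Y) - (k + 1))\<^sup>2))"
    unfolding cardI Pow_insert using insert.hyps
    by (subst sum.union_disjoint) (auto simp: k_def algebra_simps)
  also have "(\<Sum>Y\<in>insert x ` Pow S. exp (l * (2 * real (card Y) - (k + 1))\<^sup>2))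
      = (\<Sum>Y\<in>Pow S. exp (l * ((2 * real (card Y) - k) + 1)\<^sup>2))"
    unfolding sum.reindex[OF inj]
  proof (intro sum.cong refl, simp only: o_apply)
    fix Y assume "Y \<in> Pow S"
    hence "card (insert x Y) = Suc (card Y)"
      using insert.hyps finite_subset by (subst card_insert_disjoint) auto
    thus "exp (l * (2 * real (card (insert x Y)) - (k + 1))\<^sup>2)
            = exp (l * ((2 * real (card Y) - k) + 1)\<^sup>2)"
      by (simp add: algebra_simps)
  qed
  also have "(\<Sum>Y\<in>Pow S. exp (l * (2 * real (card Y) - (k + 1))\<^sup>2))
      + (\<Sum>Y\<in>Pow S. exp (l * ((2 * real (card Y) - k) + 1)\<^sup>2))
      = (\<Sum>Y\<in>Pow S. exp (l * ((2 * real (card Y) - k) - 1)\<^sup>2)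
          + exp (l * ((2 * real (card Y) - k) + 1)\<^sup>2))"
    by (simp add: sum.distrib diff_diff_eq)
  also have "\<dots> \<le> (\<Sum>Y\<in>Pow S. 2 * exp l * exp (m * (2 * real (card Y) - k)\<^sup>2))"
    by (intro sum_mono pair)
  also have "\<dots> = 2 * exp l * (\<Sum>Y\<in>Pow S. exp (m * (2 * real (card Y) - k)\<^sup>2))"
    by (simp add: sum_distrib_left)
  also have "\<dots> \<le> 2 * exp l * (2 ^ card S / (1 - 2 * m * k))"
    using insert.IH[of m] m0 mk l1 by (intro mult_left_mono) (auto simp: k_def)
  also have "\<dots> \<le> 2 ^ card (insert x S) / (1 - 2 * l * card (insert x S))"
  proof -
    have pos: "0 < 1 - 2 * l * (k + 1)" using l1 by simp
    have pos': "0 < 1 - 2 * m * k" using pos mk by linarith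
    have "exp l / (1 - 2 * m * k) \<le> 1 / (1 - 2 * l * (k + 1))"
      using step pos pos' by (simp add: divide_simps mult.commute)
    hence "(2 * 2 ^ card S) * (exp l / (1 - 2 * m * k)) \<le> (2 * 2 ^ card S) * (1 / (1 - 2 * l * (k + 1)))"
      by (intro mult_left_mono) auto
    thus ?thesis unfolding cardI by (simp add: k_def algebra_simps)
  qed
  finally show ?case .
qed

section \<open>Bounds on central binomial coefficients\<close>

text \<open>Pascal's rule and symmetry halve the new coefficient, and absorption brings it back to
  row \<open>2 * j\<close>. The ratio is kept free of division for the two inductions that
  follow.\<close>

lemma central_binomial_Suc:
  "real (2 * Suc j choose Suc j) * (real j + 1) = 2 * (2 * real j + 1) * real (2 * j choose j)"
proof -
  have a: "(2 * Suc j choose Suc j) = 2 * (Suc (2 * j) choose Suc j)"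
    using binomial_symmetric[of j "Suc (2 * j)"] binomial_Suc_Suc[of "Suc (2 * j)" j]
    by (simp add: Suc_diff_le del: binomial_Suc_Suc)
  have b: "Suc j * (Suc (2 * j) choose Suc j) = Suc (2 * j) * (2 * j choose j)"
    using Suc_times_binomial_eq[of "2 * j" j] by (simp del: binomial_Suc_Suc)
  have "real (Suc j) * real (Suc (2 * j) choose Suc j) = real (Suc (2 * j)) * real (2 * j choose j)"
    using b by (metis of_nat_mult)
  thus ?thesis unfolding a by (simp add: algebra_simps del: binomial_Suc_Suc)
qed

text \<open>The left side divided by \<open>16 ^ j\<close> does not increase, since
  \<open>(2 * x + 1) * (2 * x + 3) \<le> 4 * (x + 1)\<^sup>2\<close>.\<close>

lemma central_binomial_square_upper: "(real (2 * j choose j))\<^sup>2 * (2 * real j + 1) \<le> 16 ^ j"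
proof (induction j)
  case 0
  then show ?case by simp
next
  case (Suc j)
  define a b x where "a = real (2 * Suc j choose Suc j)" and "b = real (2 * j choose j)"
    and "x = real j"
  have ab: "a * (x + 1) = 2 * (2 * x + 1) * b"
    using central_binomial_Suc[of j] by (simp add: a_def b_def x_def del: binomial_Suc_Suc)
  have x0: "x \<ge> 0" by (simp add: x_def)
  have "(x + 1)\<^sup>2 * (a\<^sup>2 * (2 * x + 3)) = (a * (x + 1))\<^sup>2 * (2 * x + 3)"
    by (simp add: power_mult_distrib)
  also have "\<dots> = 4 * ((2 * x + 1) * (2 * x + 3)) * (b\<^sup>2 * (2 * x + 1))"
    unfolding ab by (simp add: power2_eq_square algebra_simps)
  also have "\<dots> \<le> 4 * ((2 * x + 1) * (2 * x + 3)) * 16 ^ j"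
    using Suc x0 by (intro mult_left_mono) (auto simp: b_def x_def)
  also have "\<dots> \<le> 4 * (4 * (x + 1)\<^sup>2) * 16 ^ j"
    by (intro mult_right_mono mult_left_mono) (auto simp: power2_eq_square algebra_simps)
  finally have "(x + 1)\<^sup>2 * (a\<^sup>2 * (2 * x + 3)) \<le> (x + 1)\<^sup>2 * 16 ^ Suc j" by (simp add: mult_ac)
  hence "a\<^sup>2 * (2 * x + 3) \<le> 16 ^ Suc j" using x0 by (simp add: mult_le_cancel_left)
  thus ?case by (simp add: a_def x_def algebra_simps del: binomial_Suc_Suc)
qed

text \<open>The right side divided by \<open>16 ^ j\<close> does not decrease, since
  \<open>4 * x * (x + 1) \<le> (2 * x + 1)\<^sup>2\<close>.\<close>

lemma central_binomial_square_lower: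
  assumes "j \<ge> 1"
  shows "16 ^ j \<le> 4 * real j * (real (2 * j choose j))\<^sup>2"
  using assms
proof (induction j rule: dec_induct)
  case base
  then show ?case by (simp add: numeral_2_eq_2)
next
  case (step j)
  define a b x where "a = real (2 * Suc j choose Suc j)" and "b = real (2 * j choose j)"
    and "x = real j"
  have ab: "a * (x + 1) = 2 * (2 * x + 1) * b"
    using central_binomial_Suc[of j] by (simp add: a_def b_def x_def del: binomial_Suc_Suc)
  have x0: "x \<ge> 0" by (simp add: x_def)
  have "(x + 1) * 16 ^ Suc j \<le> (x + 1) * (16 * (4 * x * b\<^sup>2))"
    using step.IH x0 by (intro mult_left_mono) (auto simp: b_def x_def)
  also have "\<dots> \<le> 4 * (2 * (2 * x + 1) * b)\<^sup>2"
    by (simp add: power2_eq_square algebra_simps)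
  also have "\<dots> = (x + 1) * (4 * (x + 1) * a\<^sup>2)"
    unfolding ab[symmetric] by (simp add: power2_eq_square algebra_simps)
  finally have "16 ^ Suc j \<le> 4 * (x + 1) * a\<^sup>2" using x0 by (simp add: mult_le_cancel_left)
  thus ?case by (simp add: a_def x_def algebra_simps del: binomial_Suc_Suc)
qed

text \<open>For odd \<open>m\<close> the middle coefficient is half the central one of row
  \<open>m + 1\<close>, which yields even the factor \<open>m + 2\<close>.\<close>

lemma middle_binomial_square_upper:
  "(real (m choose (m div 2)))\<^sup>2 * (real m + 1) \<le> 4 ^ m"
proof (cases "even m")
  case True
  then obtain j where m: "m = 2 * j" by blast
  show ?thesis using central_binomial_square_upper[of j] by (simp add: m power_mult)
next
  case False
  then obtain j where m: "m = 2 * j + 1" by (meson oddE)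
  have "(2 * Suc j choose Suc j) = 2 * (m choose (m div 2))"
    using binomial_symmetric[of j "Suc (2 * j)"] binomial_Suc_Suc[of "Suc (2 * j)" j]
    by (simp add: m Suc_diff_le del: binomial_Suc_Suc)
  hence "4 * ((real (m choose (m div 2)))\<^sup>2 * (real m + 2)) \<le> 4 * 4 ^ m"
    using central_binomial_square_upper[of "Suc j"] power_mult[of "4::real" 2 j]
    by (simp add: m power_mult_distrib mult.commute algebra_simps del: binomial_Suc_Suc)
  moreover have "(real (m choose (m div 2)))\<^sup>2 * (real m + 1)
      \<le> (real (m choose (m div 2)))\<^sup>2 * (real m + 2)"
    by (intro mult_left_mono) auto
  ultimately show ?thesis by linarith
qed

text \<open>Both sides have order \<open>4 ^ m\<close> over the root of \<open>m\<close>. Squaring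
  avoids the roots, and the two square bounds meet at \<open>16 ^ m\<close>.\<close>

lemma middle_binomial_le_central_binomial:
  assumes "m \<ge> 1"
  shows "real (m choose (m div 2)) * 2 ^ m \<le> 2 * real (2 * m choose m)"
proof (rule power2_le_imp_le)
  let ?a = "real (m choose (m div 2))" and ?b = "real (2 * m choose m)"
  have p: "(2 ^ m)\<^sup>2 = (4::real) ^ m"
    by (simp add: power2_eq_square flip: power_mult_distrib)
  have "(real m + 1) * (?a * 2 ^ m)\<^sup>2 = (?a\<^sup>2 * (real m + 1)) * 4 ^ m"
    unfolding power_mult_distrib p by simp
  also have "\<dots> \<le> 4 ^ m * 4 ^ m"
    by (intro mult_right_mono middle_binomial_square_upper) auto
  also have "\<dots> = 16 ^ m" by (simp flip: power_mult_distrib)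
  also have "\<dots> \<le> 4 * real m * ?b\<^sup>2" by (rule central_binomial_square_lower[OF assms])
  also have "\<dots> \<le> (real m + 1) * (2 * ?b)\<^sup>2"
    by (simp add: power_mult_distrib algebra_simps)
  finally show "(?a * 2 ^ m)\<^sup>2 \<le> (2 * ?b)\<^sup>2" by (simp add: mult_le_cancel_left)
qed auto

section \<open>Overlap of two random halves\<close>

text \<open>Once \<open>Y = S \<inter> S'\<close> is fixed, \<open>S'\<close> is determined by
  \<open>S' - S\<close>, a set of size \<open>m - card Y\<close> inside the \<open>m\<close> points
  of \<open>V - S\<close>. So every fibre is at most a middle binomial coefficient.\<close>

lemma sum_inter_subsets_le:
  fixes F :: "'a set \<Rightarrow> real"
  assumes V: "finite V" "card V = 2 * m" and S: "S \<subseteq> V" "card S = m"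
    and F: "\<And>Y. F Y \<ge> 0"
  shows "(\<Sum>S'\<in>{S'. S' \<subseteq> V \<and> card S' = m}. F (S \<inter> S'))
           \<le> real (m choose (m div 2)) * (\<Sum>Y\<in>Pow S. F Y)"
proof -
  let ?X = "{S'. S' \<subseteq> V \<and> card S' = m}"
  have finX: "finite ?X" using V by auto
  have finS: "finite S" using S V finite_subset by blast
  have fib: "card {S'\<in>?X. S \<inter> S' = Y} \<le> m choose (m div 2)" if Y: "Y \<in> Pow S" for Y
  proof -
    have "card {S'\<in>?X. S \<inter> S' = Y} \<le> card {Z. Z \<subseteq> V - S \<and> card Z = m - card Y}"
    proof (rule card_inj_on_le)
      show "inj_on (\<lambda>S'. S' - S) {S'\<in>?X. S \<inter> S' = Y}" by (auto simp: inj_on_def)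
      show "(\<lambda>S'. S' - S) ` {S'\<in>?X. S \<inter> S' = Y} \<subseteq> {Z. Z \<subseteq> V - S \<and> card Z = m - card Y}"
      proof clarsimp
        fix S' assume "S' \<subseteq> V" "m = card S'" "Y = S \<inter> S'"
        thus "S' - S \<subseteq> V - S \<and> card (S' - S) = card S' - card (S \<inter> S')"
          using V finite_subset[of S' V] by (auto simp: card_Diff_subset_Int Int_commute)
      qed
      show "finite {Z. Z \<subseteq> V - S \<and> card Z = m - card Y}" using V by auto
    qed
    also have "\<dots> = m choose (m - card Y)"
      using V S finS by (subst n_subsets) (auto simp: card_Diff_subset)
    also have "\<dots> \<le> m choose (m div 2)" by (rule binomial_maximum)
    finally show ?thesis .
  qed
  have "(\<Sum>S'\<in>?X. F (S \<inter> S')) = (\<Sum>Y\<in>Pow S. \<Sum>S'\<in>{S'\<in>?X. S \<inter> S' = Y}. F (S \<inter> S'))"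
    using finX finS by (intro sum.group[symmetric]) auto
  also have "\<dots> = (\<Sum>Y\<in>Pow S. real (card {S'\<in>?X. S \<inter> S' = Y}) * F Y)"
    by (intro sum.cong refl) simp
  also have "\<dots> \<le> (\<Sum>Y\<in>Pow S. real (m choose (m div 2)) * F Y)"
    using fib F by (intro sum_mono mult_right_mono) auto
  finally show ?thesis by (simp add: sum_distrib_left)
qed

lemma exp_mult_le_convex:
  fixes \<epsilon> z :: real
  assumes "0 \<le> \<epsilon>" "\<epsilon> \<le> 1"
  shows "exp (\<epsilon> * z) \<le> 1 + \<epsilon> * (exp z - 1)"
  using convex_onD[OF exp_convex, of \<epsilon> 0 z] assms by (simp add: algebra_simps)

text \<open>The comparison with the binomial law loses a factor 2, so applied at
  \<open>\<epsilon>\<close> directly it could not give a mean tending to 1. It is therefore used at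
  \<open>\<epsilon> = 1\<close> only, where the mean is at most 4, and convexity interpolates
  between that and the trivial value at 0.\<close>

lemma sum_exp_overlap_le:
  fixes \<epsilon> :: real
  assumes V: "finite V" "card V = 2 * m" and S: "S \<subseteq> V" "card S = m" and m: "m \<ge> 1"
    and \<epsilon>: "0 \<le> \<epsilon>" "\<epsilon> \<le> 1"
  shows "(\<Sum>S'\<in>{S'. S' \<subseteq> V \<and> card S' = m}.
            exp (\<epsilon> * ((2 * real (card (S \<inter> S')) - real m)\<^sup>2 / (4 * real m))))
           \<le> real (2 * m choose m) * (1 + 3 * \<epsilon>)"
proof -
  let ?X = "{S'. S' \<subseteq> V \<and> card S' = m}"
  let ?z = "\<lambda>Y. (2 * real (card Y) - real m)\<^sup>2 / (4 * real m)"
  let ?N = "real (2 * m choose m)"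
  have finS: "finite S" using S V finite_subset by blast
  have cardX: "card ?X = 2 * m choose m" using V by (simp add: n_subsets)
  have "(\<Sum>Y\<in>Pow S. exp (?z Y)) = (\<Sum>Y\<in>Pow S. exp (1 / (4 * real m) * (2 * real (card Y) - real (card S))\<^sup>2))"
    using S by simp
  \<comment> \<open>The parameter \<open>1 / (4 * real m)\<close> is chosen so that the denominator
    equals 1/2.\<close>
  also have "\<dots> \<le> 2 ^ card S / (1 - 2 * (1 / (4 * real m)) * card S)"
    using m S finS by (intro sum_exp_square_subsets_le) auto
  also have "\<dots> = 2 * 2 ^ m" using m S by simp
  finally have 1: "(\<Sum>Y\<in>Pow S. exp (?z Y)) \<le> 2 * 2 ^ m" .
  have "(\<Sum>S'\<in>?X. exp (?z (S \<inter> S'))) \<le> real (m choose (m div 2)) * (\<Sum>Y\<in>Pow S. exp (?z Y))"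
    by (intro sum_inter_subsets_le V S) auto
  also have "\<dots> \<le> real (m choose (m div 2)) * (2 * 2 ^ m)"
    by (intro mult_left_mono 1) auto
  also have "\<dots> \<le> 4 * ?N" using middle_binomial_le_central_binomial[OF m] by (simp add: mult_ac)
  finally have 2: "(\<Sum>S'\<in>?X. exp (?z (S \<inter> S'))) \<le> 4 * ?N" .
  have "(\<Sum>S'\<in>?X. exp (\<epsilon> * ?z (S \<inter> S'))) \<le> (\<Sum>S'\<in>?X. 1 + \<epsilon> * (exp (?z (S \<inter> S')) - 1))"
    by (intro sum_mono exp_mult_le_convex \<epsilon>)
  also have "\<dots> = ?N + \<epsilon> * ((\<Sum>S'\<in>?X. exp (?z (S \<inter> S'))) - ?N)"
    by (simp add: sum.distrib sum_subtractf cardX flip: sum_distrib_left)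
  also have "\<dots> \<le> ?N + \<epsilon> * (4 * ?N - ?N)"
    using 2 \<epsilon> by (intro add_left_mono mult_left_mono diff_right_mono) auto
  finally show ?thesis by (simp add: algebra_simps)
qed

section \<open>Conditioning, tests and the divergence of mixtures\<close>

text \<open>As \<open>g\<close> recovers the mixing variable from the outcome, the components have
  disjoint supports. The event then has probability \<open>pmf D t\<close>, and normalising by it
  leaves the component \<open>K t\<close>.\<close>

lemma cond_bind_pmf:
  assumes t: "t \<in> set_pmf D" and g: "\<And>s x. x \<in> set_pmf (K s) \<Longrightarrow> g x = s"
  shows "cond_pmf (bind_pmf D K) {x. g x = t} = K t"
proof (rule pmf_eqI)
  fix x
  have "map_pmf g (K s) = return_pmf s" for s
    using map_pmf_cong[OF refl g[of _ s], of "K s"] by (simp add: map_pmf_const)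
  hence "map_pmf g (bind_pmf D K) = D"
    by (simp add: map_bind_pmf bind_return_pmf')
  hence m: "measure_pmf.prob (bind_pmf D K) {x. g x = t} = pmf D t"
    using pmf_map[of g "bind_pmf D K" t] by (simp add: vimage_def)
  obtain y where "y \<in> set_pmf (K t)" using set_pmf_not_empty[of "K t"] by blast
  hence ne: "set_pmf (bind_pmf D K) \<inter> {x. g x = t} \<noteq> {}" using t g by auto
  have z: "pmf (K s) x = 0" if "s \<noteq> g x" for s using g[of x s] that by (auto simp: set_pmf_iff)
  have "pmf (bind_pmf D K) x = (\<integral>s. pmf (K s) x \<partial>D)" by (rule pmf_bind)
  also have "\<dots> = (\<Sum>s\<in>{g x}. pmf (K s) x * pmf D s)"
    by (rule integral_measure_pmf_real) (use z in auto)
  finally have b: "pmf (bind_pmf D K) x = pmf (K (g x)) x * pmf D (g x)" by simp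
  show "pmf (cond_pmf (bind_pmf D K) {x. g x = t}) x = pmf (K t) x"
    using z[of t] t by (auto simp: pmf_cond[OF ne] m b set_pmf_iff)
qed

text \<open>Cauchy-Schwarz with the difference of the densities split as its quotient by the root of
  \<open>P\<close>, times that root. For empty \<open>S\<close> it says that the divergence is
  nonnegative.\<close>

lemma prob_diff_square_le_chi2_div:
  assumes X: "finite X" "set_pmf Q \<subseteq> X" "set_pmf P = X"
  shows "(measure_pmf.prob Q S - measure_pmf.prob P S)\<^sup>2 \<le> chi2_div X Q P"
proof -
  let ?d = "\<lambda>x. pmf Q x - pmf P x"
  have P0: "pmf P x > 0" if "x \<in> X" for x using that X by (simp add: pmf_positive_iff)
  have pr: "measure_pmf.prob M S = (\<Sum>x\<in>X \<inter> S. pmf M x)" if "set_pmf M \<subseteq> X" for M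
  proof -
    have "measure_pmf.prob M S = measure_pmf.prob M (X \<inter> S)"
      using that by (intro measure_eq_AE) (auto simp: AE_measure_pmf_iff)
    thus ?thesis using X by (simp add: measure_measure_pmf_finite)
  qed
  have tot: "(\<Sum>x\<in>X. pmf M x) = 1" if "set_pmf M \<subseteq> X" for M
    using that X by (intro sum_pmf_eq_1) auto
  have "(measure_pmf.prob Q S - measure_pmf.prob P S)\<^sup>2
      = (\<Sum>x\<in>X \<inter> S. (?d x / sqrt (pmf P x)) * sqrt (pmf P x))\<^sup>2"
    using P0 X by (simp add: pr sum_subtractf[symmetric])
      (intro arg_cong[where f = "\<lambda>x. x\<^sup>2"] sum.cong refl, force)
  also have "\<dots> \<le> (\<Sum>x\<in>X \<inter> S. (?d x / sqrt (pmf P x))\<^sup>2) * (\<Sum>x\<in>X \<inter> S. (sqrt (pmf P x))\<^sup>2)"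
    by (rule Cauchy_Schwarz_ineq_sum)
  also have "\<dots> \<le> (\<Sum>x\<in>X. (?d x / sqrt (pmf P x))\<^sup>2) * (\<Sum>x\<in>X. (sqrt (pmf P x))\<^sup>2)"
    using X by (intro mult_mono sum_mono2 sum_nonneg) auto
  also have "(\<Sum>x\<in>X. (sqrt (pmf P x))\<^sup>2) = 1" using tot[of P] X by simp
  also have "(\<Sum>x\<in>X. (?d x / sqrt (pmf P x))\<^sup>2)
      = (\<Sum>x\<in>X. (pmf Q x)\<^sup>2 / pmf P x - 2 * pmf Q x + pmf P x)"
  proof (intro sum.cong refl)
    fix x assume "x \<in> X"
    with P0[of x] show "(?d x / sqrt (pmf P x))\<^sup>2 = (pmf Q x)\<^sup>2 / pmf P x - 2 * pmf Q x + pmf P x"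
      by (simp add: power_divide) (simp add: field_simps power2_eq_square)
  qed
  also have "\<dots> = chi2_div X Q P"
    using tot[of P] tot[of Q] X
    by (simp add: sum.distrib sum_subtractf chi2_div_def flip: sum_distrib_left)
  finally show ?thesis by simp
qed

text \<open>Convexity of the square at each point \<open>x\<close>. It serves for the average over
  \<tau>, where every component is already close to \<open>P\<close>.\<close>

lemma chi2_div_mixture_le:
  assumes S: "finite S" "S \<noteq> {}" and b: "\<And>s. s \<in> S \<Longrightarrow> chi2_div X (Q s) P \<le> b"
  shows "chi2_div X (bind_pmf (pmf_of_set S) Q) P \<le> b"
proof -
  let ?N = "real (card S)"
  have N: "?N > 0" using S by (simp add: card_gt_0_iff)
  have sq: "((\<Sum>s\<in>S. pmf (Q s) x) / ?N)\<^sup>2 \<le> (\<Sum>s\<in>S. (pmf (Q s) x)\<^sup>2) / ?N" for x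
    using sum_squared_le_sum_of_squares[of "\<lambda>s. pmf (Q s) x" S] N
    by (simp add: power_divide divide_simps power2_eq_square mult_ac)
  have "chi2_div X (bind_pmf (pmf_of_set S) Q) P
      = (\<Sum>x\<in>X. ((\<Sum>s\<in>S. pmf (Q s) x) / ?N)\<^sup>2 / pmf P x) - 1"
    using S by (simp add: chi2_div_def pmf_bind_pmf_of_set)
  also have "\<dots> \<le> (\<Sum>x\<in>X. ((\<Sum>s\<in>S. (pmf (Q s) x)\<^sup>2) / ?N) / pmf P x) - 1"
    by (intro diff_right_mono sum_mono divide_right_mono sq) auto
  also have "(\<Sum>x\<in>X. ((\<Sum>s\<in>S. (pmf (Q s) x)\<^sup>2) / ?N) / pmf P x)
      = (\<Sum>s\<in>S. (\<Sum>x\<in>X. (pmf (Q s) x)\<^sup>2 / pmf P x)) / ?N"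
    by (subst sum.swap) (simp add: sum_divide_distrib mult.commute)
  also have "\<dots> \<le> (\<Sum>s\<in>S. b + 1) / ?N"
    using b by (intro divide_right_mono sum_mono) (auto simp: chi2_div_def algebra_simps)
  finally show ?thesis using N by simp
qed

text \<open>For the average over \<sigma> convexity is too weak, because the divergence at one fixed
  labelling need not be small. The square of the mixture is expanded over pairs instead, and it
  suffices to bound each row of the resulting matrix.\<close>

lemma chi2_div_mixture_le_pairs:
  assumes S: "finite S" "S \<noteq> {}"
    and b: "\<And>s. s \<in> S \<Longrightarrow> (\<Sum>s'\<in>S. \<Sum>x\<in>X. pmf (Q s) x * pmf (Q s') x / pmf P x) \<le> real (card S) * (1 + b)"
  shows "chi2_div X (bind_pmf (pmf_of_set S) Q) P \<le> b"
proof -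
  let ?N = "real (card S)"
  have N: "?N > 0" using S by (simp add: card_gt_0_iff)
  have "chi2_div X (bind_pmf (pmf_of_set S) Q) P
      = (\<Sum>x\<in>X. \<Sum>s\<in>S. \<Sum>s'\<in>S. pmf (Q s) x * pmf (Q s') x / pmf P x) / ?N\<^sup>2 - 1"
    using S by (simp add: chi2_div_def pmf_bind_pmf_of_set power_divide sum_divide_distrib
        power2_eq_square sum_product mult_ac)
  also have "(\<Sum>x\<in>X. \<Sum>s\<in>S. \<Sum>s'\<in>S. pmf (Q s) x * pmf (Q s') x / pmf P x)
      = (\<Sum>s\<in>S. \<Sum>x\<in>X. \<Sum>s'\<in>S. pmf (Q s) x * pmf (Q s') x / pmf P x)"
    by (rule sum.swap)
  also have "\<dots> = (\<Sum>s\<in>S. \<Sum>s'\<in>S. \<Sum>x\<in>X. pmf (Q s) x * pmf (Q s') x / pmf P x)"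
    by (intro sum.cong refl sum.swap)
  also have "\<dots> / ?N\<^sup>2 - 1 \<le> (\<Sum>s\<in>S. ?N * (1 + b)) / ?N\<^sup>2 - 1"
    by (intro diff_right_mono divide_right_mono sum_mono b) auto
  also have "\<dots> = b" using N by (simp add: power2_eq_square)
  finally show ?thesis .
qed

section \<open>Second moments of product Bernoulli likelihood ratios\<close>

text \<open>The sum is the mean, under the law with parameter \<open>r\<close>, of a product of two
  likelihood ratios. Independence of the entries factorises it, and one entry contributes
  \<open>p e * q e / r + (1 - p e) * (1 - q e) / (1 - r)\<close>.\<close>

lemma sum_Pi_bernoulli_ratio:
  fixes p q :: "'a \<Rightarrow> real" and r :: real
  assumes E: "finite E" and r: "0 < r" "r < 1"
    and p: "\<And>e. e \<in> E \<Longrightarrow> p e \<in> {0..1}" and q: "\<And>e. e \<in> E \<Longrightarrow> q e \<in> {0..1}"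
  shows "(\<Sum>A\<in>PiE_dflt E False (\<lambda>_. UNIV).
            pmf (Pi_pmf E False (\<lambda>e. bernoulli_pmf (p e))) A
              * pmf (Pi_pmf E False (\<lambda>e. bernoulli_pmf (q e))) A
              / pmf (Pi_pmf E False (\<lambda>_. bernoulli_pmf r)) A)
           = (\<Prod>e\<in>E. 1 + (p e - r) * (q e - r) / (r * (1 - r)))"
proof -
  let ?X = "PiE_dflt E False (\<lambda>_. UNIV :: bool set)"
  \<comment> \<open>The squared denominator leaves one factor of the reference law free to act as
    the weight of the expectation.\<close>
  let ?f = "\<lambda>e b. pmf (bernoulli_pmf (p e)) b * pmf (bernoulli_pmf (q e)) b
              / (pmf (bernoulli_pmf r) b)\<^sup>2"
  have r0: "pmf (bernoulli_pmf r) b > 0" for b using r by (cases b) auto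
  have finX: "finite ?X" using E by (intro finite_PiE_dflt) auto
  have "(\<Sum>A\<in>?X. pmf (Pi_pmf E False (\<lambda>e. bernoulli_pmf (p e))) A
              * pmf (Pi_pmf E False (\<lambda>e. bernoulli_pmf (q e))) A
              / pmf (Pi_pmf E False (\<lambda>_. bernoulli_pmf r)) A)
      = (\<Sum>A\<in>?X. (\<Prod>e\<in>E. ?f e (A e)) * pmf (Pi_pmf E False (\<lambda>_. bernoulli_pmf r)) A)"
  proof (intro sum.cong refl)
    fix A assume "A \<in> ?X"
    hence A: "A e = False" if "e \<notin> E" for e using that by (auto simp: PiE_dflt_def)
    have "(\<Prod>e\<in>E. pmf (bernoulli_pmf (p e)) (A e)) * (\<Prod>e\<in>E. pmf (bernoulli_pmf (q e)) (A e))
              / (\<Prod>e\<in>E. pmf (bernoulli_pmf r) (A e))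
        = (\<Prod>e\<in>E. ?f e (A e) * pmf (bernoulli_pmf r) (A e))"
      unfolding prod.distrib[symmetric] prod_dividef[symmetric]
      using r0 by (intro prod.cong refl) (simp add: power2_eq_square less_imp_neq[symmetric])
    also have "\<dots> = (\<Prod>e\<in>E. ?f e (A e)) * (\<Prod>e\<in>E. pmf (bernoulli_pmf r) (A e))"
      by (rule prod.distrib)
    finally show "pmf (Pi_pmf E False (\<lambda>e. bernoulli_pmf (p e))) A
              * pmf (Pi_pmf E False (\<lambda>e. bernoulli_pmf (q e))) A
              / pmf (Pi_pmf E False (\<lambda>_. bernoulli_pmf r)) A
        = (\<Prod>e\<in>E. ?f e (A e)) * pmf (Pi_pmf E False (\<lambda>_. bernoulli_pmf r)) A"
      using A E by (simp add: pmf_Pi')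
  qed
  also have "\<dots> = measure_pmf.expectation (Pi_pmf E False (\<lambda>_. bernoulli_pmf r)) (\<lambda>A. \<Prod>e\<in>E. ?f e (A e))"
    using finX set_Pi_pmf_subset[OF E, of False "\<lambda>_. bernoulli_pmf r"]
    by (intro integral_measure_pmf_real[symmetric]) (auto simp: PiE_dflt_def)
  also have "\<dots> = (\<Prod>e\<in>E. measure_pmf.expectation (bernoulli_pmf r) (?f e))"
    using E by (intro expectation_prod_Pi_pmf integrable_measure_pmf_finite) auto
  also have "\<dots> = (\<Prod>e\<in>E. 1 + (p e - r) * (q e - r) / (r * (1 - r)))"
  proof (intro prod.cong refl)
    fix e assume e: "e \<in> E"
    have "measure_pmf.expectation (bernoulli_pmf r) (?f e)
        = p e * q e / r\<^sup>2 * r + (1 - p e) * (1 - q e) / (1 - r)\<^sup>2 * (1 - r)"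
      using p[OF e] q[OF e] r by simp
    also have "\<dots> = p e * q e / r + (1 - p e) * (1 - q e) / (1 - r)"
      using r by (simp add: power2_eq_square)
    also have "\<dots> = 1 + (p e - r) * (q e - r) / (r * (1 - r))"
      using r by (simp add: divide_simps) (simp add: algebra_simps)
    finally show "measure_pmf.expectation (bernoulli_pmf r) (?f e)
        = 1 + (p e - r) * (q e - r) / (r * (1 - r))" .
  qed
  finally show ?thesis .
qed

section \<open>Sums over entries and balanced labellings\<close>

lemma sum_pairs_mult:
  fixes x :: "nat \<Rightarrow> real"
  shows "2 * (\<Sum>(i, j)\<in>{(i, j). 1 \<le> i \<and> i < j \<and> j \<le> n}. x i * x j)
           = (\<Sum>i\<in>{1..n}. x i)\<^sup>2 - (\<Sum>i\<in>{1..n}. (x i)\<^sup>2)"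
proof (induction n)
  case 0
  have empty: "{(i, j). 1 \<le> i \<and> i < j \<and> j \<le> (0::nat)} = {}" by auto
  show ?case unfolding empty by simp
next
  case (Suc n)
  let ?P = "\<lambda>n. {(i, j). 1 \<le> i \<and> i < j \<and> j \<le> (n::nat)}"
  have un: "?P (Suc n) = ?P n \<union> (\<lambda>i. (i, Suc n)) ` {1..n}" by (auto simp: image_iff)
  have fin: "finite (?P n)" by (rule finite_subset[of _ "{1..n} \<times> {1..n}"]) auto
  have "(\<Sum>(i, j)\<in>?P (Suc n). x i * x j) = (\<Sum>(i, j)\<in>?P n. x i * x j) + (\<Sum>i\<in>{1..n}. x i * x (Suc n))"
    unfolding un using fin by (subst sum.union_disjoint) (auto simp: sum.reindex inj_on_def)
  thus ?case using Suc by (simp add: power2_sum algebra_simps flip: sum_distrib_left sum_distrib_right)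
qed

lemma entries_eq_Times: "entries n T = {1..T} \<times> {(i, j). 1 \<le> i \<and> i < j \<and> j \<le> n}"
  by (auto simp: entries_def)

lemma finite_entries [simp]: "finite (entries n T)"
  by (rule finite_subset[of _ "{1..T} \<times> {1..n} \<times> {1..n}"]) (auto simp: entries_def)

text \<open>Every layer \<open>t\<close> has the same sum over pairs; discarding the nonnegative
  diagonal squares gives the bound.\<close>

lemma sum_entries_mult_le:
  fixes x :: "nat \<Rightarrow> real"
  shows "(\<Sum>(t, i, j)\<in>entries n T. x i * x j) \<le> real T / 2 * (\<Sum>i\<in>{1..n}. x i)\<^sup>2"
proof -
  let ?P = "{(i, j). 1 \<le> i \<and> i < j \<and> j \<le> n}"
  have "(\<Sum>(t, i, j)\<in>entries n T. x i * x j) = (\<Sum>t\<in>{1..T}. \<Sum>(i, j)\<in>?P. x i * x j)"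
    by (simp only: entries_eq_Times sum.cartesian_product)
  also have "\<dots> = real T / 2 * (2 * (\<Sum>(i, j)\<in>?P. x i * x j))" by simp
  also have "\<dots> \<le> real T / 2 * (\<Sum>i\<in>{1..n}. x i)\<^sup>2"
    unfolding sum_pairs_mult by (intro mult_left_mono) (auto intro: sum_nonneg)
  finally show ?thesis .
qed

definition ones :: "nat \<Rightarrow> (nat \<Rightarrow> nat) \<Rightarrow> nat set" where
  "ones n \<sigma> = {i \<in> {1..n}. \<sigma> i = 1}"

lemma balanced_range: "\<sigma> \<in> balanced n \<Longrightarrow> i \<in> {1..n} \<Longrightarrow> \<sigma> i = 0 \<or> \<sigma> i = 1"
  by (auto simp: balanced_def PiE_def Pi_def)

lemma sum_eq_card_ones:
  assumes "\<And>i. i \<in> {1..n} \<Longrightarrow> \<sigma> i = 0 \<or> \<sigma> i = (1::nat)"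
  shows "(\<Sum>i\<in>{1..n}. \<sigma> i) = card (ones n \<sigma>)"
proof -
  have "(\<Sum>i\<in>{1..n}. \<sigma> i) = (\<Sum>i\<in>{1..n}. if \<sigma> i = 1 then 1 else 0)"
    using assms by (intro sum.cong) fastforce+
  thus ?thesis by (simp add: ones_def sum.If_cases Int_def)
qed

text \<open>Turns sums over labellings into sums over \<open>m\<close>-subsets, where the overlap
  bound applies.\<close>

lemma bij_betw_ones:
  assumes "n = 2 * m"
  shows "bij_betw (ones n) (balanced n) {S. S \<subseteq> {1..n} \<and> card S = m}"
\<comment> \<open>The inverse is restricted to \<open>{1..n}\<close> because balanced labellings are
  extensional, that is \<open>undefined\<close> elsewhere.\<close>
proof (rule bij_betwI[where g = "\<lambda>S. \<lambda>i\<in>{1..n}. if i \<in> S then 1 else 0"])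
  show "ones n \<in> balanced n \<rightarrow> {S. S \<subseteq> {1..n} \<and> card S = m}"
  proof safe
    fix \<sigma> assume \<sigma>: "\<sigma> \<in> balanced n"
    hence "real (\<Sum>i\<in>{1..n}. \<sigma> i) = real n / 2"
      by (simp add: balanced_def)
    hence "real (card (ones n \<sigma>)) = real n / 2"
      using sum_eq_card_ones[of n \<sigma>] balanced_range[OF \<sigma>] by metis
    thus "card (ones n \<sigma>) = m" using assms by simp
  qed (auto simp: ones_def)
  show "(\<lambda>S. \<lambda>i\<in>{1..n}. if i \<in> S then 1 else 0) \<in> {S. S \<subseteq> {1..n} \<and> card S = m} \<rightarrow> balanced n"
  proof safe
    fix S :: "nat set" assume S: "S \<subseteq> {1..n}" "m = card S"
    have "(\<Sum>i\<in>{1..n}. (\<lambda>i\<in>{1..n}. if i \<in> S then 1 else (0::nat)) i) = card S"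
      using S by (simp add: sum.If_cases Int_absorb1)
    hence "real (\<Sum>i\<in>{1..n}. (\<lambda>i\<in>{1..n}. if i \<in> S then 1 else (0::nat)) i) = real n / 2"
      unfolding assms S by simp
    thus "(\<lambda>i\<in>{1..n}. if i \<in> S then 1 else 0) \<in> balanced n"
      unfolding balanced_def by auto
  qed
  show "(\<lambda>i\<in>{1..n}. if i \<in> ones n \<sigma> then 1 else 0) = \<sigma>" if "\<sigma> \<in> balanced n" for \<sigma>
  proof
    fix i
    show "(\<lambda>i\<in>{1..n}. if i \<in> ones n \<sigma> then 1 else 0) i = \<sigma> i"
      using balanced_range[OF that, of i] that
      by (cases "i \<in> {1..n}") (auto simp: ones_def balanced_def PiE_def extensional_def)
  qed
  show "ones n (\<lambda>i\<in>{1..n}. if i \<in> S then 1 else 0) = S"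
    if "S \<in> {S. S \<subseteq> {1..n} \<and> card S = m}" for S
    using that by (auto simp: ones_def split: if_splits)
qed

lemma finite_balanced [simp]: "finite (balanced n)"
  unfolding balanced_def by (rule finite_subset[of _ "{1..n} \<rightarrow>\<^sub>E {0, 1}"]) (auto intro: finite_PiE)

lemma card_balanced: "n = 2 * m \<Longrightarrow> card (balanced n) = n choose m"
  using bij_betw_same_card[OF bij_betw_ones] by (simp add: n_subsets)

lemma balanced_nonempty: "even n \<Longrightarrow> balanced n \<noteq> {}"
  using card_balanced[of n "n div 2"] zero_less_binomial[of "n div 2" n] by fastforce

text \<open>In \<open>(2 * a - 1) * (2 * b - 1) = 4 * a * b - 2 * a - 2 * b + 1\<close> the linear
  terms have fixed sums by balance, so only the overlap remains.\<close>

lemma sum_sign_products: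
  assumes n: "n = 2 * m" and \<sigma>: "\<sigma> \<in> balanced n" and \<sigma>': "\<sigma>' \<in> balanced n"
  shows "(\<Sum>i\<in>{1..n}. (2 * real (\<sigma> i) - 1) * (2 * real (\<sigma>' i) - 1))
           = 2 * (2 * real (card (ones n \<sigma> \<inter> ones n \<sigma>')) - real m)"
proof -
  have b: "(\<Sum>i\<in>{1..n}. real (s i)) = real m" if "s \<in> balanced n" for s
    using that n by (simp add: balanced_def)
  have "(\<Sum>i\<in>{1..n}. \<sigma> i * \<sigma>' i) = card (ones n (\<lambda>i. \<sigma> i * \<sigma>' i))"
    using balanced_range[OF \<sigma>] balanced_range[OF \<sigma>'] by (intro sum_eq_card_ones) fastforce
  also have "ones n (\<lambda>i. \<sigma> i * \<sigma>' i) = ones n \<sigma> \<inter> ones n \<sigma>'" by (auto simp: ones_def)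
  finally have p: "(\<Sum>i\<in>{1..n}. real (\<sigma> i) * real (\<sigma>' i)) = real (card (ones n \<sigma> \<inter> ones n \<sigma>'))"
    by (metis (no_types, lifting) of_nat_mult of_nat_sum sum.cong)
  have "(\<Sum>i\<in>{1..n}. (2 * real (\<sigma> i) - 1) * (2 * real (\<sigma>' i) - 1))
      = (\<Sum>i\<in>{1..n}. 4 * (real (\<sigma> i) * real (\<sigma>' i)) - 2 * real (\<sigma> i) - 2 * real (\<sigma>' i) + 1)"
    by (intro sum.cong refl) (simp add: algebra_simps)
  also have "\<dots> = 4 * real (card (ones n \<sigma> \<inter> ones n \<sigma>')) - 2 * real m - 2 * real m + real n"
    by (simp add: sum.distrib sum_subtractf p b \<sigma> \<sigma>' del: One_nat_def flip: sum_distrib_left)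
  finally show ?thesis using n by simp
qed

section \<open>The laws of the model as mixtures\<close>

text \<open>\<tau> comes before \<sigma> so that the partial application to \<tau> is the kernel
  mixed over \<sigma>.\<close>

definition graph_law :: "nat \<Rightarrow> nat \<Rightarrow> real \<Rightarrow> (nat \<Rightarrow> nat) \<Rightarrow> (nat \<Rightarrow> nat) \<Rightarrow> array pmf" where
  "graph_law n T \<rho> \<tau> \<sigma> = Pi_pmf (entries n T) False
     (\<lambda>(t, i, j). bernoulli_pmf (Bmat \<rho> (\<tau> t) (\<sigma> i) (\<sigma> j)))"

text \<open>The independent draws are exchanged: with \<tau> outermost, conditioning on it falls
  under \<open>cond_bind_pmf\<close>.\<close>

lemma joint_law_eq:
  "joint_law n T \<rho> = bind_pmf (pmf_of_set (balanced T)) (\<lambda>\<tau>.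
     bind_pmf (pmf_of_set (balanced n)) (\<lambda>\<sigma>. map_pmf (\<lambda>A. (A, \<sigma>, \<tau>)) (graph_law n T \<rho> \<tau> \<sigma>)))"
  unfolding joint_law_def graph_law_def map_pmf_def by (rule bind_commute_pmf)

lemma alt_law_given_eq:
  assumes "\<tau> \<in> balanced T"
  shows "alt_law_given \<tau> n T \<rho> = bind_pmf (pmf_of_set (balanced n)) (graph_law n T \<rho> \<tau>)"
proof -
  let ?K = "\<lambda>\<tau>. bind_pmf (pmf_of_set (balanced n)) (\<lambda>\<sigma>. map_pmf (\<lambda>A. (A, \<sigma>, \<tau>)) (graph_law n T \<rho> \<tau> \<sigma>))"
  have "balanced T \<noteq> {}" using assms by auto
  hence \<tau>: "\<tau> \<in> set_pmf (pmf_of_set (balanced T))"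
    using assms by (simp add: set_pmf_of_set)
  have "{(A, \<sigma>, \<tau>'). \<tau>' = \<tau>} = {x :: array \<times> (nat \<Rightarrow> nat) \<times> (nat \<Rightarrow> nat). snd (snd x) = \<tau>}"
    by auto
  hence "cond_pmf (joint_law n T \<rho>) {(A, \<sigma>, \<tau>'). \<tau>' = \<tau>}
      = cond_pmf (bind_pmf (pmf_of_set (balanced T)) ?K) {x. snd (snd x) = \<tau>}"
    by (simp add: joint_law_eq)
  also have "\<dots> = ?K \<tau>"
    by (intro cond_bind_pmf \<tau>) auto
  finally show ?thesis
    by (simp add: alt_law_given_def map_bind_pmf pmf.map_comp o_def)
qed

lemma alt_law_eq:
  assumes "balanced T \<noteq> {}"
  shows "alt_law n T \<rho> = bind_pmf (pmf_of_set (balanced T)) (\<lambda>\<tau>. alt_law_given \<tau> n T \<rho>)"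
proof -
  have "alt_law n T \<rho> = bind_pmf (pmf_of_set (balanced T)) (\<lambda>\<tau>.
      bind_pmf (pmf_of_set (balanced n)) (graph_law n T \<rho> \<tau>))"
    by (simp add: alt_law_def joint_law_eq map_bind_pmf pmf.map_comp o_def)
  also have "\<dots> = bind_pmf (pmf_of_set (balanced T)) (\<lambda>\<tau>. alt_law_given \<tau> n T \<rho>)"
    using assms by (intro bind_pmf_cong refl) (simp add: alt_law_given_eq)
  finally show ?thesis .
qed

lemma finite_arrays: "finite (arrays n T)"
  unfolding arrays_def by (intro finite_PiE_dflt) auto

lemma set_pmf_null_law:
  assumes "0 < \<rho>" "\<rho> < 1"
  shows "set_pmf (null_law n T \<rho>) = arrays n T"
  using assms by (simp add: null_law_def arrays_def set_Pi_pmf o_def set_pmf_bernoulli)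

lemma set_pmf_alt_law: "set_pmf (alt_law n T \<rho>) \<subseteq> arrays n T"
  using set_Pi_pmf_subset[OF finite_entries]
  by (fastforce simp: alt_law_def joint_law_def arrays_def PiE_dflt_def)

text \<open>The sign of \<open>\<tau> t\<close> enters both factors and cancels.\<close>

lemma Bmat_deviation_mult:
  assumes "a = 0 \<or> a = 1" "b = 0 \<or> b = 1" "a' = 0 \<or> a' = 1" "b' = 0 \<or> b' = 1"
  shows "(Bmat \<rho> k a b - \<rho>) * (Bmat \<rho> k a' b' - \<rho>) = \<rho>\<^sup>2 / 4 *
           (((2 * real a - 1) * (2 * real a' - 1)) * ((2 * real b - 1) * (2 * real b' - 1)))"
  using assms by (auto simp: Bmat_def power2_eq_square)

section \<open>The divergence bound at fixed size\<close>

lemma sum_graph_law_ratio_le: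
  assumes n: "n = 2 * m" and \<rho>: "0 < \<rho>" "\<rho> < 2 / 3"
    and \<sigma>: "\<sigma> \<in> balanced n" and \<sigma>': "\<sigma>' \<in> balanced n"
  shows "(\<Sum>A\<in>arrays n T. pmf (graph_law n T \<rho> \<tau> \<sigma>) A * pmf (graph_law n T \<rho> \<tau> \<sigma>') A
            / pmf (null_law n T \<rho>) A)
           \<le> exp (real T * \<rho> / (2 * (1 - \<rho>)) * (2 * real (card (ones n \<sigma> \<inter> ones n \<sigma>')) - real m)\<^sup>2)"
proof -
  define x where "x i = (2 * real (\<sigma> i) - 1) * (2 * real (\<sigma>' i) - 1)" for i
  \<comment> \<open>Each entry deviates from \<rho> by \<open>\<rho> / 2\<close> in absolute value,
    and \<open>(\<rho> / 2)\<^sup>2 / (\<rho> * (1 - \<rho>))\<close> is \<open>c\<close>.\<close>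
  define c where "c = \<rho> / (4 * (1 - \<rho>))"
  let ?p = "\<lambda>\<sigma> (t, i, j). Bmat \<rho> (\<tau> t) (\<sigma> i) (\<sigma> j)"
  have p01: "?p \<sigma> e \<in> {0..1}" for \<sigma> e
    using \<rho> by (auto simp: Bmat_def split: prod.splits)
  \<comment> \<open>\<open>c \<le> 1\<close> makes all factors \<open>1 + c * (x i * x j)\<close>
    nonnegative, as the factorwise comparison with exp requires.\<close>
  have c: "0 \<le> c" "c \<le> 1" using \<rho> by (auto simp: c_def divide_simps)
  have g: "graph_law n T \<rho> \<tau> s = Pi_pmf (entries n T) False (\<lambda>e. bernoulli_pmf (?p s e))" for s
    unfolding graph_law_def by (intro Pi_pmf_cong refl) auto
  have fac: "1 + (?p \<sigma> e - \<rho>) * (?p \<sigma>' e - \<rho>) / (\<rho> * (1 - \<rho>)) = (case e of (t, i, j) \<Rightarrow> 1 + c * (x i * x j))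
      \<and> 0 \<le> (case e of (t, i, j) \<Rightarrow> 1 + c * (x i * x j))"
    if e: "e \<in> entries n T" for e
  proof -
    obtain t i j where eq: "e = (t, i, j)" by (cases e)
    have ij: "i \<in> {1..n}" "j \<in> {1..n}" using e by (auto simp: eq entries_def)
    note b = balanced_range[OF \<sigma> ij(1)] balanced_range[OF \<sigma> ij(2)]
      balanced_range[OF \<sigma>' ij(1)] balanced_range[OF \<sigma>' ij(2)]
    have "1 + (?p \<sigma> e - \<rho>) * (?p \<sigma>' e - \<rho>) / (\<rho> * (1 - \<rho>)) = 1 + \<rho>\<^sup>2 / 4 * (x i * x j) / (\<rho> * (1 - \<rho>))"
      by (simp only: eq prod.case x_def Bmat_deviation_mult[OF b])
    also have "\<dots> = 1 + c * (x i * x j)"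
      using \<rho> by (simp add: c_def power2_eq_square)
    finally have 1: "1 + (?p \<sigma> e - \<rho>) * (?p \<sigma>' e - \<rho>) / (\<rho> * (1 - \<rho>)) = 1 + c * (x i * x j)" .
    have "x i * x j = 1 \<or> x i * x j = -1" using b by (auto simp: x_def)
    hence "0 \<le> 1 + c * (x i * x j)" using c by auto
    with 1 show ?thesis by (simp add: eq)
  qed
  have "(\<Sum>A\<in>arrays n T. pmf (graph_law n T \<rho> \<tau> \<sigma>) A * pmf (graph_law n T \<rho> \<tau> \<sigma>') A
            / pmf (null_law n T \<rho>) A)
      = (\<Prod>e\<in>entries n T. 1 + (?p \<sigma> e - \<rho>) * (?p \<sigma>' e - \<rho>) / (\<rho> * (1 - \<rho>)))"
    unfolding arrays_def null_law_def g
    using \<rho> by (intro sum_Pi_bernoulli_ratio p01) auto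
  also have "\<dots> = (\<Prod>(t, i, j)\<in>entries n T. 1 + c * (x i * x j))"
    using fac by (intro prod.cong refl) blast
  also have "\<dots> \<le> (\<Prod>(t, i, j)\<in>entries n T. exp (c * (x i * x j)))"
    using fac by (intro prod_mono) (auto split: prod.splits)
  also have "\<dots> = exp (c * (\<Sum>(t, i, j)\<in>entries n T. x i * x j))"
    by (simp add: exp_sum sum_distrib_left case_prod_beta)
  also have "\<dots> \<le> exp (c * (real T / 2 * (\<Sum>i\<in>{1..n}. x i)\<^sup>2))"
    using c by (simp only: exp_le_cancel_iff) (intro mult_left_mono sum_entries_mult_le)
  also have "(\<Sum>i\<in>{1..n}. x i) = 2 * (2 * real (card (ones n \<sigma> \<inter> ones n \<sigma>')) - real m)"
    unfolding x_def by (rule sum_sign_products[OF n \<sigma> \<sigma>'])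
  also have "c * (real T / 2 * (2 * (2 * real (card (ones n \<sigma> \<inter> ones n \<sigma>')) - real m))\<^sup>2)
      = real T * \<rho> / (2 * (1 - \<rho>)) * (2 * real (card (ones n \<sigma> \<inter> ones n \<sigma>')) - real m)\<^sup>2"
    using \<rho> unfolding c_def power_mult_distrib[of 2] by (simp add: divide_simps)
  finally show ?thesis .
qed

lemma chi2_div_alt_law_given_le:
  assumes n: "even n" "n > 0" and \<rho>: "0 < \<rho>" "\<rho> < 2 / 3"
    and \<tau>: "\<tau> \<in> balanced T" and small: "3 * (real n * real T * \<rho>) \<le> 1"
  shows "chi2_div (arrays n T) (alt_law_given \<tau> n T \<rho>) (null_law n T \<rho>) \<le> 9 * (real n * real T * \<rho>)"
proof -
  obtain m where m: "n = 2 * m" using n by blast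
  have m1: "m \<ge> 1" using n m by simp
  \<comment> \<open>\<open>\<rho> < 2 / 3\<close> gives
    \<open>1 / (2 * (1 - \<rho>)) \<le> 3 / 2\<close>, and with \<open>n = 2 * m\<close> this makes
    the exponent at most \<epsilon> times the one normalised by \<open>4 * m\<close>.\<close>
  define \<epsilon> where "\<epsilon> = 3 * (real n * real T * \<rho>)"
  have \<epsilon>: "0 \<le> \<epsilon>" "\<epsilon> \<le> 1" using \<rho> small by (auto simp: \<epsilon>_def)
  have rate: "real T * \<rho> / (2 * (1 - \<rho>)) * z\<^sup>2 \<le> \<epsilon> * (z\<^sup>2 / (4 * real m))" for z
  proof -
    have "real T * \<rho> / (2 * (1 - \<rho>)) \<le> real T * \<rho> * (3 / 2)"
      using mult_left_mono[of "1 / (2 * (1 - \<rho>))" "3 / 2" "real T * \<rho>"] \<rho>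
      by (simp add: divide_simps)
    hence "real T * \<rho> / (2 * (1 - \<rho>)) * z\<^sup>2 \<le> real T * \<rho> * (3 / 2) * z\<^sup>2"
      by (rule mult_right_mono) simp
    also have "\<dots> = \<epsilon> * (z\<^sup>2 / (4 * real m))"
      using m1 by (simp add: \<epsilon>_def m)
    finally show ?thesis .
  qed
  have "chi2_div (arrays n T) (bind_pmf (pmf_of_set (balanced n)) (graph_law n T \<rho> \<tau>)) (null_law n T \<rho>)
      \<le> 3 * \<epsilon>"
  proof (rule chi2_div_mixture_le_pairs)
    show "balanced n \<noteq> {}" using n by (intro balanced_nonempty)
    fix \<sigma> assume \<sigma>: "\<sigma> \<in> balanced n"
    have S: "ones n \<sigma> \<subseteq> {1..n}" "card (ones n \<sigma>) = m"
      using bij_betwE[OF bij_betw_ones[OF m]] \<sigma> by auto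
    let ?h = "\<lambda>S'. exp (\<epsilon> * ((2 * real (card (ones n \<sigma> \<inter> S')) - real m)\<^sup>2 / (4 * real m)))"
    have "(\<Sum>\<sigma>'\<in>balanced n. \<Sum>A\<in>arrays n T. pmf (graph_law n T \<rho> \<tau> \<sigma>) A
              * pmf (graph_law n T \<rho> \<tau> \<sigma>') A / pmf (null_law n T \<rho>) A)
        \<le> (\<Sum>\<sigma>'\<in>balanced n. ?h (ones n \<sigma>'))"
    proof (rule sum_mono)
      fix \<sigma>' assume "\<sigma>' \<in> balanced n"
      from sum_graph_law_ratio_le[OF m \<rho> \<sigma> this, of T \<tau>]
      show "(\<Sum>A\<in>arrays n T. pmf (graph_law n T \<rho> \<tau> \<sigma>) A
              * pmf (graph_law n T \<rho> \<tau> \<sigma>') A / pmf (null_law n T \<rho>) A) \<le> ?h (ones n \<sigma>')"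
        by (rule order_trans) (simp only: exp_le_cancel_iff rate)
    qed
    also have "\<dots> = (\<Sum>S'\<in>{S'. S' \<subseteq> {1..n} \<and> card S' = m}. ?h S')"
      by (rule sum.reindex_bij_betw[OF bij_betw_ones[OF m]])
    also have "\<dots> \<le> real (2 * m choose m) * (1 + 3 * \<epsilon>)"
      using m by (intro sum_exp_overlap_le S m1 \<epsilon>) auto
    also have "\<dots> = real (card (balanced n)) * (1 + 3 * \<epsilon>)"
      by (simp add: card_balanced[OF m] flip: m)
    finally show "(\<Sum>\<sigma>'\<in>balanced n. \<Sum>A\<in>arrays n T. pmf (graph_law n T \<rho> \<tau> \<sigma>) A
              * pmf (graph_law n T \<rho> \<tau> \<sigma>') A / pmf (null_law n T \<rho>) A)
        \<le> real (card (balanced n)) * (1 + 3 * \<epsilon>)" .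
  qed simp
  thus ?thesis by (simp add: alt_law_given_eq[OF \<tau>] \<epsilon>_def)
qed

lemma set_pmf_alt_law_given:
  assumes "balanced n \<noteq> {}" "\<tau> \<in> balanced T"
  shows "set_pmf (alt_law_given \<tau> n T \<rho>) \<subseteq> arrays n T"
  using set_Pi_pmf_subset[OF finite_entries] assms
  by (fastforce simp: alt_law_given_eq graph_law_def arrays_def PiE_dflt_def)

lemma chi2_div_alt_law_le:
  assumes "even n" "n > 0" "even T" "0 < \<rho>" "\<rho> < 2 / 3" "3 * (real n * real T * \<rho>) \<le> 1"
  shows "chi2_div (arrays n T) (alt_law n T \<rho>) (null_law n T \<rho>) \<le> 9 * (real n * real T * \<rho>)"
  unfolding alt_law_eq[OF balanced_nonempty[OF assms(3)]]
  using assms by (intro chi2_div_mixture_le chi2_div_alt_law_given_le balanced_nonempty) auto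

section \<open>Limits along even sizes and impossibility of testing\<close>

lemma even_at_top_neq_bot: "even_at_top \<noteq> bot"
proof
  assume "even_at_top = bot"
  hence "eventually (\<lambda>n. odd n) (at_top :: nat filter)"
    using eventually_inf_principal[of "\<lambda>_. False" at_top "{n::nat. even n}"]
    by (simp add: even_at_top_def)
  then obtain N :: nat where "\<And>n. n \<ge> N \<Longrightarrow> odd n" by (auto simp: eventually_at_top_linorder)
  from this[of "2 * N"] show False by simp
qed

theorem theorem4p1:
  fixes T :: "nat \<Rightarrow> nat" and \<rho> :: "nat \<Rightarrow> real"
  assumes T_even: "\<And>n. even n \<Longrightarrow> n > 0 \<Longrightarrow> even (T n) \<and> T n > 0"
    and rho_range: "\<And>n. even n \<Longrightarrow> n > 0 \<Longrightarrow> 0 < \<rho> n \<and> \<rho> n < 2 / 3"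
    and T_lim: "filterlim T at_top even_at_top"
    and rho_lim: "(\<rho> \<longlongrightarrow> 0) even_at_top"
    and rho_inv: "(\<lambda>n. inverse (\<rho> n)) \<in> o[even_at_top](\<lambda>n. (real n)\<^sup>2)"
    and nTrho: "((\<lambda>n. real n * real (T n) * \<rho> n) \<longlongrightarrow> 0) even_at_top"
  shows "(\<forall>\<tau> :: nat \<Rightarrow> nat \<Rightarrow> nat. (\<forall>n. even n \<longrightarrow> n > 0 \<longrightarrow> \<tau> n \<in> balanced (T n)) \<longrightarrow>
            (\<lambda>n. chi2_div (arrays n (T n)) (alt_law_given (\<tau> n) n (T n) (\<rho> n)) (null_law n (T n) (\<rho> n)))
              \<in> o[even_at_top](\<lambda>_. 1))
       \<and> (\<lambda>n. chi2_div (arrays n (T n)) (alt_law n (T n) (\<rho> n)) (null_law n (T n) (\<rho> n)))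
              \<in> o[even_at_top](\<lambda>_. 1)
       \<and> \<not> distinguishable (\<lambda>n. alt_law n (T n) (\<rho> n)) (\<lambda>n. null_law n (T n) (\<rho> n))"
proof -
  let ?P0 = "\<lambda>n. null_law n (T n) (\<rho> n)" and ?P1 = "\<lambda>n. alt_law n (T n) (\<rho> n)"
  have "eventually (\<lambda>n. even n \<and> n > 0) even_at_top"
    unfolding even_at_top_def eventually_inf_principal
    by (rule eventually_mono[OF eventually_gt_at_top[of 0]]) auto
  moreover have "eventually (\<lambda>n. real n * real (T n) * \<rho> n < 1 / 3) even_at_top"
    using order_tendstoD(2)[OF nTrho, of "1 / 3"] by simp
  ultimately have ev: "eventually (\<lambda>n. (even n \<and> n > 0) \<and> 3 * (real n * real (T n) * \<rho> n) \<le> 1) even_at_top"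
    by eventually_elim auto
  have bound_lim: "((\<lambda>n. 9 * (real n * real (T n) * \<rho> n)) \<longlongrightarrow> 0) even_at_top"
    using tendsto_mult_right_zero[OF nTrho] by simp
  \<comment> \<open>One sandwich argument serves both the conditional and the averaged laws; for the
    former the upper bound does not depend on \<tau>.\<close>
  have lim0: "((\<lambda>n. chi2_div (arrays n (T n)) (Q n) (?P0 n)) \<longlongrightarrow> 0) even_at_top"
    if sub: "\<And>n. even n \<Longrightarrow> n > 0 \<Longrightarrow> set_pmf (Q n) \<subseteq> arrays n (T n)"
      and le: "\<And>n. even n \<Longrightarrow> n > 0 \<Longrightarrow> 3 * (real n * real (T n) * \<rho> n) \<le> 1
        \<Longrightarrow> chi2_div (arrays n (T n)) (Q n) (?P0 n) \<le> 9 * (real n * real (T n) * \<rho> n)" for Q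
  proof (rule tendsto_sandwich[OF _ _ tendsto_const bound_lim])
    show "eventually (\<lambda>n. 0 \<le> chi2_div (arrays n (T n)) (Q n) (?P0 n)) even_at_top"
      using ev
    proof eventually_elim
      case (elim n)
      \<comment> \<open>The empty event gives the lower bound 0.\<close>
      have "(measure_pmf.prob (Q n) {} - measure_pmf.prob (?P0 n) {})\<^sup>2
          \<le> chi2_div (arrays n (T n)) (Q n) (?P0 n)"
        using elim rho_range[of n] sub[of n]
        by (intro prob_diff_square_le_chi2_div finite_arrays set_pmf_null_law) auto
      thus ?case by simp
    qed
    show "eventually (\<lambda>n. chi2_div (arrays n (T n)) (Q n) (?P0 n)
        \<le> 9 * (real n * real (T n) * \<rho> n)) even_at_top"
      using ev by eventually_elim (use le in blast)
  qed
  have given: "((\<lambda>n. chi2_div (arrays n (T n)) (alt_law_given (\<tau> n) n (T n) (\<rho> n)) (?P0 n)) \<longlongrightarrow> 0) even_at_top"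
    if \<tau>: "\<forall>n. even n \<longrightarrow> n > 0 \<longrightarrow> \<tau> n \<in> balanced (T n)" for \<tau> :: "nat \<Rightarrow> nat \<Rightarrow> nat"
    using \<tau> rho_range
    by (intro lim0 set_pmf_alt_law_given chi2_div_alt_law_given_le balanced_nonempty) auto
  have mixed: "((\<lambda>n. chi2_div (arrays n (T n)) (?P1 n) (?P0 n)) \<longlongrightarrow> 0) even_at_top"
    using rho_range T_even by (intro lim0 set_pmf_alt_law chi2_div_alt_law_le) auto
  have "\<not> distinguishable ?P1 ?P0"
  proof
    assume "distinguishable ?P1 ?P0"
    then obtain \<psi> where \<psi>: "((\<lambda>n. measure_pmf.prob (?P1 n) {A. \<not> \<psi> n A} + measure_pmf.prob (?P0 n) {A. \<psi> n A})
        \<longlongrightarrow> 0) even_at_top"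
      unfolding distinguishable_def by blast
    let ?err = "\<lambda>n. measure_pmf.prob (?P1 n) {A. \<not> \<psi> n A} + measure_pmf.prob (?P0 n) {A. \<psi> n A}"
    \<comment> \<open>One minus the total error is the difference of the two acceptance
      probabilities, so its square is below the divergence. Vanishing error would force
      \<open>1 \<le> 0\<close> in the limit, the filter being proper.\<close>
    have "((\<lambda>n. (1 - ?err n)\<^sup>2) \<longlongrightarrow> (1 - 0)\<^sup>2) even_at_top"
      by (intro tendsto_intros \<psi>)
    moreover have "eventually (\<lambda>n. (1 - ?err n)\<^sup>2 \<le> chi2_div (arrays n (T n)) (?P1 n) (?P0 n)) even_at_top"
      using ev
    proof eventually_elim
      case (elim n)
      have "measure_pmf.prob (?P1 n) {A. \<not> \<psi> n A} = 1 - measure_pmf.prob (?P1 n) {A. \<psi> n A}"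
        using measure_pmf.prob_compl[of "{A. \<psi> n A}" "?P1 n"]
        by (simp add: Compl_eq_Diff_UNIV[symmetric] Collect_neg_eq)
      hence "1 - ?err n = measure_pmf.prob (?P1 n) {A. \<psi> n A} - measure_pmf.prob (?P0 n) {A. \<psi> n A}"
        by simp
      thus ?case
        using elim rho_range[of n]
        by (simp only:) (intro prob_diff_square_le_chi2_div finite_arrays set_pmf_alt_law set_pmf_null_law, auto)
    qed
    ultimately have "(1 - 0)\<^sup>2 \<le> (0::real)"
      by (intro tendsto_le[OF even_at_top_neq_bot mixed])
    thus False by simp
  qed
  moreover have "f \<in> o[even_at_top](\<lambda>_. 1)" if "(f \<longlongrightarrow> 0) even_at_top" for f :: "nat \<Rightarrow> real"
    using that by (intro smalloI_tendsto) auto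
  ultimately show ?thesis using given mixed by blast
qed

end
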